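(* Let $\vec{c}\in\mathbb{F}_q^n\setminus\{\vec 0\}$ and let $w$ be an integer. The following three statements are equivalent: 1. $w_H(\vec c)=w$. 2. $w$ is the maximal integer for which there exists a vector space $V\subseteq\mathbb{F}_q^n$ of dimension $w$ such that for any $\vec v\in V\setminus\{\vec 0\}$ it holds that $\vec c\ast\vec v\neq\vec 0$. 3. $w$ is the maximal integer for which there exist a linearly independent set $\{\vec w_1,\ldots,\vec w_w\}\subseteq\mathbb{F}_q^n$ (of $w$ vectors) and a corresponding set of vectors $\{\vec v_1,\ldots,\vec v_w\}\subseteq\mathbb{F}_q^n$ such that $\vec c\ast\vec v_1=\vec w_1,\ldots,\vec c\ast\vec v_w=\vec w_w$.
   Context: $\mathbb{F}_q$ is the finite field with $q$ elements, $w_H$ denotes Hamming weight (number of nonzero entries), and $\vec a\ast\vec b=(a_1b_1,\ldots,a_nb_n)$ is the componentwise product. *)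

theory Defs
  imports "HOL-Analysis.Cartesian_Space"
begin

definition hamming_weight :: "'a::zero ^ 'n::finite \<Rightarrow> nat" where
  "hamming_weight c = card {i. c $ i \<noteq> 0}"

definition is_greatest :: "('a::order \<Rightarrow> bool) \<Rightarrow> 'a \<Rightarrow> bool" where
  "is_greatest P k \<longleftrightarrow> P k \<and> (\<forall>l. P l \<longrightarrow> l \<le> k)"

end

theory Submission
  imports Defs
begin

text \<open>
  Multiplication by \<open>c\<close> is linear, its kernel consists of the vectors vanishing on the support
  of \<open>c\<close>, and its image is the space of vectors vanishing off that support, whose dimension is
  the Hamming weight of \<open>c\<close>. A subspace meeting the kernel trivially embeds into the image, and
  the vectors \<open>c * v\<^sub>i\<close> lie in it; the image itself attains both bounds.
\<close>

text \<open>By antisymmetry, it is enough to exhibit one greatest value; a maximality claim about an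
  arbitrary \<open>w\<close> then becomes an equation.\<close>

lemma is_greatest_unique:
  assumes "is_greatest P k"
  shows "is_greatest P w \<longleftrightarrow> k = w"
  using assms unfolding is_greatest_def by (metis order.antisym)

text \<open>For \<open>S\<close> the support of \<open>c\<close>, this coordinate subspace is both
  the image of multiplication by \<open>c\<close> and a complement of its kernel, so it can serve as
  witness for both maxima.\<close>

definition supported_on :: "'n set \<Rightarrow> ('a::field ^ 'n::finite) set" where
  "supported_on S = {x. \<forall>i. i \<notin> S \<longrightarrow> x $ i = 0}"

lemma subspace_supported_on: "vec.subspace (supported_on S)"
  by (auto simp: vec.subspace_def supported_on_def)

lemma dim_supported_on: "vec.dim (supported_on S :: ('a::field ^ 'n::finite) set) = card S"
  unfolding supported_on_def by (rule dim_substandard_cart)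

lemma dim_supported_on_support:
  fixes c :: "'a::field ^ 'n::finite"
  shows "vec.dim (supported_on {i. c $ i \<noteq> 0} :: ('a ^ 'n) set) = hamming_weight c"
  by (simp add: dim_supported_on hamming_weight_def)

lemma linear_times_vec:
  fixes c :: "'a::field ^ 'n::finite"
  shows "Vector_Spaces.linear (*s) (*s) ((*) c)"
  by unfold_locales (auto simp: vec_eq_iff algebra_simps)

lemma times_vec_in_supported_on: "c * v \<in> supported_on {i. c $ i \<noteq> 0}"
  by (simp add: supported_on_def)

lemma times_vec_nonzero:
  fixes c :: "'a::field ^ 'n::finite"
  assumes "v \<in> supported_on {i. c $ i \<noteq> 0}" "v \<noteq> 0"
  shows "c * v \<noteq> 0"
  using assms by (auto simp: supported_on_def vec_eq_iff)

text \<open>Dividing by \<open>c\<close> gives a preimage; off the support the quotient is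
  \<open>0\<close> by convention, and both sides vanish there.\<close>

lemma times_vec_surj_supported_on:
  fixes c :: "'a::field ^ 'n::finite"
  assumes "x \<in> supported_on {i. c $ i \<noteq> 0}"
  shows "c * (\<chi> i. x $ i / c $ i) = x"
  using assms by (auto simp: supported_on_def vec_eq_iff)

lemma dim_le_hamming_weight:
  fixes c :: "'a::field ^ 'n::finite"
  assumes V: "vec.subspace V" and nz: "\<forall>v \<in> V - {0}. c * v \<noteq> 0"
  shows "vec.dim V \<le> hamming_weight c"
proof -
  have "inj_on ((*) c) V"
  proof (rule inj_onI, rule ccontr)
    fix x y assume "x \<in> V" "y \<in> V" "c * x = c * y" "x \<noteq> y"
    then have "x - y \<in> V - {0}" "c * (x - y) = 0"
      using vec.subspace_diff[OF V] by (auto simp: algebra_simps)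
    with nz show False by blast
  qed
  then have "vec.dim V = vec.dim ((*) c ` V)"
    \<comment> \<open>Preserving dimension needs injectivity on the span of \<open>V\<close>, which
      is \<open>V\<close> itself.\<close>
    using V by (intro vec.dim_image_eq[OF linear_times_vec, symmetric]) (simp add: vec.span_eq_iff[THEN iffD2])
  also have "\<dots> \<le> vec.dim (supported_on {i. c $ i \<noteq> 0} :: ('a ^ 'n) set)"
    by (intro vec.dim_subset image_subsetI times_vec_in_supported_on)
  finally show ?thesis
    by (simp add: dim_supported_on_support)
qed

lemma is_greatest_dim:
  fixes c :: "'a::field ^ 'n::finite"
  shows "is_greatest (\<lambda>k::int. \<exists>V :: ('a ^ 'n) set.
      vec.subspace V \<and> int (vec.dim V) = k \<and> (\<forall>v \<in> V - {0}. c * v \<noteq> 0))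
    (int (hamming_weight c))"
  unfolding is_greatest_def
proof (intro conjI allI impI)
  show "\<exists>V :: ('a ^ 'n) set. vec.subspace V \<and> int (vec.dim V) = int (hamming_weight c) \<and>
      (\<forall>v \<in> V - {0}. c * v \<noteq> 0)"
    using subspace_supported_on dim_supported_on_support times_vec_nonzero
    by (intro exI[of _ "supported_on {i. c $ i \<noteq> 0}"]) auto
qed (use dim_le_hamming_weight in auto)

text \<open>The cardinality condition makes \<open>ws\<close> injective on \<open>{1..k}\<close> and
  excludes negative \<open>k\<close>, where the interval is empty.\<close>

lemma is_greatest_independent:
  fixes c :: "'a::field ^ 'n::finite"
  shows "is_greatest (\<lambda>k::int. \<exists>ws vs :: int \<Rightarrow> 'a ^ 'n.
      int (card (ws ` {1..k})) = k \<and> vec.independent (ws ` {1..k}) \<and>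
      (\<forall>i \<in> {1..k}. c * vs i = ws i)) (int (hamming_weight c))"
  unfolding is_greatest_def
proof (intro conjI allI impI)
  let ?W = "supported_on {i. c $ i \<noteq> 0} :: ('a ^ 'n) set"
  let ?I = "{1..int (hamming_weight c)}"
  \<comment> \<open>The bound is attained by a basis of the image, enumerated by \<open>ws\<close>,
    with preimages obtained by division.\<close>
  obtain B where B: "B \<subseteq> ?W" "vec.independent B" "card B = hamming_weight c"
    using vec.basis_exists[of ?W] by (metis dim_supported_on_support)
  obtain ws where "bij_betw ws ?I B"
    using finite_same_card_bij[of ?I B] vec.finiteI_independent[OF B(2)] B(3) by auto
  then have ws: "ws ` ?I = B"
    by (rule bij_betw_imp_surj_on)
  have "c * (\<chi> j. ws i $ j / c $ j) = ws i" if "i \<in> ?I" for i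
    using that ws B(1) by (intro times_vec_surj_supported_on) auto
  with ws B show "\<exists>ws vs :: int \<Rightarrow> 'a ^ 'n.
      int (card (ws ` ?I)) = int (hamming_weight c) \<and> vec.independent (ws ` ?I) \<and>
      (\<forall>i \<in> ?I. c * vs i = ws i)"
    by (intro exI[of _ ws] exI[of _ "\<lambda>i. \<chi> j. ws i $ j / c $ j"]) auto
next
  fix l :: int
  assume "\<exists>ws vs :: int \<Rightarrow> 'a ^ 'n. int (card (ws ` {1..l})) = l \<and>
    vec.independent (ws ` {1..l}) \<and> (\<forall>i \<in> {1..l}. c * vs i = ws i)"
  then obtain ws vs :: "int \<Rightarrow> 'a ^ 'n" where l: "int (card (ws ` {1..l})) = l"
    and ind: "vec.independent (ws ` {1..l})" and vs: "\<forall>i \<in> {1..l}. c * vs i = ws i"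
    by blast
  \<comment> \<open>Each \<open>ws i\<close> is a multiple of \<open>c\<close>, so the independent
    set lies in the image and its size is bounded by the dimension there.\<close>
  have "ws ` {1..l} \<subseteq> supported_on {i. c $ i \<noteq> 0}"
    using vs by (metis image_subsetI times_vec_in_supported_on)
  then have "card (ws ` {1..l}) \<le> hamming_weight c"
    using vec.independent_card_le_dim[OF _ ind] by (metis dim_supported_on_support)
  with l show "l \<le> int (hamming_weight c)" by linarith
qed

theorem theorem5:
  fixes c :: "'a::{field, finite} ^ 'n::finite" and w :: int
  assumes "c \<noteq> 0"
  shows "(int (hamming_weight c) = w
      \<longleftrightarrow> is_greatest (\<lambda>k::int. \<exists>V :: ('a ^ 'n) set.
            vec.subspace V \<and> int (vec.dim V) = k \<and> (\<forall>v \<in> V - {0}. c * v \<noteq> 0)) w)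
    \<and> (is_greatest (\<lambda>k::int. \<exists>V :: ('a ^ 'n) set.
            vec.subspace V \<and> int (vec.dim V) = k \<and> (\<forall>v \<in> V - {0}. c * v \<noteq> 0)) w
      \<longleftrightarrow> is_greatest (\<lambda>k::int. \<exists>ws vs :: int \<Rightarrow> 'a ^ 'n.
            int (card (ws ` {1..k})) = k \<and> vec.independent (ws ` {1..k}) \<and>
            (\<forall>i \<in> {1..k}. c * vs i = ws i)) w)"
  \<comment> \<open>Both maximality claims turn into
    \<open>int (hamming_weight c) = w\<close>.\<close>
  unfolding is_greatest_unique[OF is_greatest_dim] is_greatest_unique[OF is_greatest_independent]
  by simp

end
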